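(* Let $n\ge 1$, let $\mathbf{x}=(x_0,x_1,\dots,x_n)\in\mathcal{X}^{n+1}$ be any sequence of contexts, and let $\pi$ be any separable policy. Then $$\mathsf{Reg}_n(\pi,\mathbf{x})=\sup_{\mu_0\in[0,1]}\ \sup_{\substack{\mu_1,\dots,\mu_n\in[0,1]\\ |\mu_i-\mu_0|\le d(x_0,x_i)\ \forall i\in\{1,\dots,n\}}}\mathbb{E}_{\mathbf{y}\sim\mathcal{B}(\mu_1)\times\cdots\times\mathcal{B}(\mu_n)}\big[R(\pi(\mathbf{x},\mathbf{y}),\mathcal{B}(\mu_0))\big].$$
   Context: Let $\mathcal{Y}=[0,1]$ and let $\Delta(\mathcal{Y})$ be the set of probability distributions on $\mathcal{Y}$; an element $F\in\Delta(\mathcal{Y})$ is identified with its cumulative distribution function (cdf). Let $\mathcal{X}$ be a set (of contexts) and $d:\mathcal{X}\times\mathcal{X}\to\mathbb{R}$ a non-negative function (the dissimilarity). Costs $c_o,c_u>0$ satisfy $c_o+c_u=1$, and $q=c_u/(c_u+c_o)$. Newsvendor loss: $\ell(a,y)=c_o(a-y)^+ + c_u(y-a)^+$ for $a,y\in\mathcal{Y}$, where $z^+=\max(0,z)$. For $a\in\mathcal{Y}$, $F_0\in\Delta(\mathcal{Y})$: $L(a,F_0)=\mathbb{E}_{y\sim F_0}[\ell(a,y)]$, $a^*_{F_0}=\inf\{a\in\mathcal{Y}: F_0(a)\ge q\}$, $R(a,F_0)=L(a,F_0)-L(a^*_{F_0},F_0)$. For $\nu\in\Delta(\mathcal{Y})$: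 $L(\nu,F_0)=\mathbb{E}_{a\sim\nu}[L(a,F_0)]$ and $R(\nu,F_0)=L(\nu,F_0)-L(a^*_{F_0},F_0)$. A data-driven policy (possibly randomized) is a map $\pi:\mathcal{X}^{n+1}\times\mathcal{Y}^n\to\Delta(\mathcal{Y})$, measurable in $\mathbf{y}$ so that all expectations below make sense. The contexts $\mathbf{x}$ are fixed. Separable policy: $\pi$ is separable if there is a function $P^\pi:[0,1]^n\to[0,1]$ (possibly depending on the fixed $\mathbf{x}$) such that for all $F_1,\dots,F_n\in\Delta(\mathcal{Y})$ and all $y\in\mathbb{R}$, $$\mathbb{P}_{\mathbf{y}\sim F_1\times\cdots\times F_n,\ a\sim\pi(\mathbf{x},\mathbf{y})}(a\le y)=P^\pi(F_1(y),\dots,F_n(y)).$$ Kolmogorov distance: $\|F-F'\|_K=\sup_{y\in\mathbb{R}}|F(y)-F'(y)|$. Worst-case regret: $$\mathsf{Reg}_n(\pi,\mathbf{x})=\sup_{F_0\in\Delta(\mathcal{Y})}\ \sup_{\substack{F_1,\dots,F_n\in\Delta(\mathcal{Y})\\ \|F_0-F_i\|_K\le d(x_0,x_i)\ \forall i\in\{1,\dots,n\}}}\mathbb{E}_{\mathbf{y}\sim F_1\times\cdots\times F_n}\big[R(\pi(\mathbf{x},\mathbf{y}),F_0)\big].$$ $\mathcal{B}(\mu)$ denotes the Bernoulli distribution on $\{0,1\}$ with mean $\mu\in[0,1]$. *)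

theory Defs
  imports "HOL-Probability.Probability"
begin

text \<open>
  The outcome space is \<open>[0,1]\<close> itself, not the real line, so distributions and the kernels
  \<open>\<pi> x\<close> live on the restricted Borel space and the members of \<open>\<Delta>\<close> need no support condition.
\<close>

definition outcome_space :: "real measure" where
  "outcome_space = restrict_space borel {0..1}"

definition outcome_dists :: "real measure set" where
  "outcome_dists = space (prob_algebra outcome_space)"

text \<open>
  The library's \<open>cdf\<close> measures \<open>{..y}\<close>, which is not an event of \<open>outcome_space\<close> for \<open>y < 1\<close>;
  hence the intersection with the space.
\<close>

definition dist_fun :: "real measure \<Rightarrow> real \<Rightarrow> real" where
  "dist_fun F y = measure F {a \<in> space F. a \<le> y}"

definition kolmogorov_dist :: "real measure \<Rightarrow> real measure \<Rightarrow> real" where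
  "kolmogorov_dist F G = (SUP y::real. \<bar>dist_fun F y - dist_fun G y\<bar>)"

definition bernoulli_dist :: "real \<Rightarrow> real measure" where
  "bernoulli_dist \<mu> = distr (measure_pmf (bernoulli_pmf \<mu>)) outcome_space of_bool"

definition newsvendor_loss :: "real \<Rightarrow> real \<Rightarrow> real \<Rightarrow> real \<Rightarrow> real" where
  "newsvendor_loss c\<^sub>o c\<^sub>u a y = c\<^sub>o * max 0 (a - y) + c\<^sub>u * max 0 (y - a)"

definition expected_loss :: "real \<Rightarrow> real \<Rightarrow> real \<Rightarrow> real measure \<Rightarrow> real" where
  "expected_loss c\<^sub>o c\<^sub>u a F\<^sub>0 = (\<integral>y. newsvendor_loss c\<^sub>o c\<^sub>u a y \<partial>F\<^sub>0)"

definition randomized_loss :: "real \<Rightarrow> real \<Rightarrow> real measure \<Rightarrow> real measure \<Rightarrow> real" where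
  "randomized_loss c\<^sub>o c\<^sub>u \<nu> F\<^sub>0 = (\<integral>a. expected_loss c\<^sub>o c\<^sub>u a F\<^sub>0 \<partial>\<nu>)"

definition critical_ratio :: "real \<Rightarrow> real \<Rightarrow> real" where
  "critical_ratio c\<^sub>o c\<^sub>u = c\<^sub>u / (c\<^sub>u + c\<^sub>o)"

definition opt_action :: "real \<Rightarrow> real \<Rightarrow> real measure \<Rightarrow> real" where
  "opt_action c\<^sub>o c\<^sub>u F\<^sub>0 = Inf {a \<in> {0..1}. dist_fun F\<^sub>0 a \<ge> critical_ratio c\<^sub>o c\<^sub>u}"

definition regret :: "real \<Rightarrow> real \<Rightarrow> real measure \<Rightarrow> real measure \<Rightarrow> real" where
  "regret c\<^sub>o c\<^sub>u \<nu> F\<^sub>0 =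
     randomized_loss c\<^sub>o c\<^sub>u \<nu> F\<^sub>0 - expected_loss c\<^sub>o c\<^sub>u (opt_action c\<^sub>o c\<^sub>u F\<^sub>0) F\<^sub>0"

text \<open>
  Tuples are extensional functions: contexts are indexed by \<open>{0..n}\<close>, samples, distributions and
  means by \<open>{1..n}\<close>.
\<close>

type_synonym 'x policy = "(nat \<Rightarrow> 'x) \<Rightarrow> (nat \<Rightarrow> real) \<Rightarrow> real measure"

definition context_seqs :: "nat \<Rightarrow> (nat \<Rightarrow> 'x) set" where
  "context_seqs n = ({0..n} \<rightarrow>\<^sub>E UNIV)"

definition data_driven_policy :: "nat \<Rightarrow> 'x policy \<Rightarrow> bool" where
  "data_driven_policy n \<pi> \<longleftrightarrow>
     (\<forall>x \<in> context_seqs n. \<pi> x \<in> (\<Pi>\<^sub>M i\<in>{1..n}. outcome_space) \<rightarrow>\<^sub>M prob_algebra outcome_space)"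

text \<open>The \<open>bind\<close> is the law of the action \<open>a \<sim> \<pi>(x,y)\<close> when \<open>y \<sim> F\<^sub>1 \<times> \<dots> \<times> F\<^sub>n\<close>.\<close>

definition separable :: "nat \<Rightarrow> (nat \<Rightarrow> 'x) \<Rightarrow> 'x policy \<Rightarrow> bool" where
  "separable n x \<pi> \<longleftrightarrow>
     (\<exists>P \<in> ({1..n} \<rightarrow>\<^sub>E {0..1}) \<rightarrow> {0..1::real}.
        \<forall>F \<in> {1..n} \<rightarrow>\<^sub>E outcome_dists. \<forall>y::real.
          dist_fun ((\<Pi>\<^sub>M i\<in>{1..n}. F i) \<bind> \<pi> x) y = P (\<lambda>i\<in>{1..n}. dist_fun (F i) y))"

definition expected_regret ::
  "real \<Rightarrow> real \<Rightarrow> nat \<Rightarrow> 'x policy \<Rightarrow> (nat \<Rightarrow> 'x) \<Rightarrow> real measure \<Rightarrow> (nat \<Rightarrow> real measure) \<Rightarrow> real" where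
  "expected_regret c\<^sub>o c\<^sub>u n \<pi> x F\<^sub>0 F =
     (\<integral>y. regret c\<^sub>o c\<^sub>u (\<pi> x y) F\<^sub>0 \<partial>(\<Pi>\<^sub>M i\<in>{1..n}. F i))"

text \<open>
  Suprema of regrets are taken in \<open>ereal\<close>, so that no boundedness is needed for them to be least
  upper bounds.
\<close>

definition worst_case_regret ::
  "real \<Rightarrow> real \<Rightarrow> ('x \<Rightarrow> 'x \<Rightarrow> real) \<Rightarrow> nat \<Rightarrow> 'x policy \<Rightarrow> (nat \<Rightarrow> 'x) \<Rightarrow> ereal" where
  "worst_case_regret c\<^sub>o c\<^sub>u d n \<pi> x =
     (SUP F\<^sub>0 \<in> outcome_dists.
      SUP F \<in> {F \<in> {1..n} \<rightarrow>\<^sub>E outcome_dists.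
                 \<forall>i\<in>{1..n}. kolmogorov_dist F\<^sub>0 (F i) \<le> d (x 0) (x i)}.
        ereal (expected_regret c\<^sub>o c\<^sub>u n \<pi> x F\<^sub>0 F))"

end

theory Submission
  imports Defs
begin

text \<open>
  The regret of a random action with cdf \<open>G\<close> is
  \<open>\<integral>\<^sub>0\<^sup>1 (c\<^sub>u - F\<^sub>0(t)) (G(t) - 1{c\<^sub>u \<le> F\<^sub>0(t)}) dt\<close>. For a separable policy \<open>G(t)\<close> is a
  function of \<open>F\<^sub>1(t), \<dots>, F\<^sub>n(t)\<close>, so the integrand at level \<open>t\<close> is exactly the regret of
  the Bernoulli instance with means \<open>1 - F\<^sub>i(t)\<close>, whose cdfs are constant on \<open>[0,1)\<close>. That
  instance satisfies the Kolmogorov constraints, and an average is at most the supremum.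
\<close>

section \<open>Distribution functions on the unit interval\<close>

text \<open>Levels exclude \<open>1\<close>, where every cdf already equals 1, so that Bernoulli
  cdfs are constant over the whole range. The total mass is 1, hence integrals over levels are
  averages.\<close>

abbreviation unit_lebesgue :: "real measure" where
  "unit_lebesgue \<equiv> restrict_space lborel {0..<1}"

lemma prob_space_unit_lebesgue: "prob_space unit_lebesgue"
  by (rule prob_spaceI) (simp add: emeasure_restrict_space)

lemma space_outcome_space: "space outcome_space = {0..1}"
  by (simp add: outcome_space_def)

lemma outcome_distsD:
  assumes "F \<in> outcome_dists"
  shows "prob_space F" "sets F = sets outcome_space" "space F = {0..1}"
  using assms sets_eq_imp_space_eq[of F outcome_space]
  by (auto simp: outcome_dists_def space_prob_algebra space_outcome_space)

lemma measurable_outcome_real: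
  assumes "sets M = sets outcome_space" "f \<in> borel_measurable borel"
  shows "f \<in> borel_measurable M"
  using measurable_restrict_space1[OF assms(2), of "{0..1}"] assms(1)
  by (simp add: outcome_space_def cong: measurable_cong_sets)

lemma measurable_real_pred_outcome:
  assumes "Measurable.pred borel Q" "sets M = sets outcome_space"
  shows "{a \<in> space M. Q a} \<in> sets M"
proof -
  have "Measurable.pred M Q"
    using measurable_restrict_space1[OF assms(1), of "{0..1}"] assms(2)
    by (simp add: outcome_space_def cong: measurable_cong_sets)
  then show ?thesis by measurable
qed

text \<open>The form in which a cdf value emerges from the inner integral once Fubini has exchanged
  the order.\<close>

lemma dist_fun_eq_integral:
  assumes "F \<in> outcome_dists"
  shows "dist_fun F t = (\<integral>y. of_bool (y \<le> t) \<partial>F)"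
proof -
  interpret prob_space F using outcome_distsD[OF assms] by simp
  have "{a \<in> space F. a \<le> t} \<in> sets F"
    using outcome_distsD[OF assms] by (intro measurable_real_pred_outcome) auto
  then have "dist_fun F t = (\<integral>y. indicator {a \<in> space F. a \<le> t} y \<partial>F)"
    by (simp add: dist_fun_def)
  also have "\<dots> = (\<integral>y. of_bool (y \<le> t) \<partial>F)"
    by (intro Bochner_Integration.integral_cong) (auto simp: indicator_def)
  finally show ?thesis .
qed

lemma dist_fun_bounds:
  assumes "F \<in> outcome_dists"
  shows "dist_fun F t \<in> {0..1}"
proof -
  interpret prob_space F using outcome_distsD[OF assms] by simp
  show ?thesis by (simp add: dist_fun_def)
qed

lemma dist_fun_mono:
  assumes "F \<in> outcome_dists"
  shows "mono (dist_fun F)"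
proof
  fix s t :: real assume "s \<le> t"
  interpret prob_space F using outcome_distsD[OF assms] by simp
  have "{a \<in> space F. a \<le> t} \<in> sets F"
    using outcome_distsD[OF assms] by (intro measurable_real_pred_outcome) auto
  then show "dist_fun F s \<le> dist_fun F t"
    unfolding dist_fun_def using \<open>s \<le> t\<close> by (intro finite_measure_mono) auto
qed

lemma borel_measurable_dist_fun:
  assumes "F \<in> outcome_dists"
  shows "dist_fun F \<in> borel_measurable borel"
  using dist_fun_mono[OF assms] by (rule borel_measurable_mono)

lemma dist_fun_neg:
  assumes "F \<in> outcome_dists" "t < 0"
  shows "dist_fun F t = 0"
proof -
  have "{a \<in> space F. a \<le> t} = {}" using outcome_distsD[OF assms(1)] assms(2) by auto
  then show ?thesis unfolding dist_fun_def by (metis measure_empty)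
qed

lemma dist_fun_ge_1:
  assumes "F \<in> outcome_dists" "t \<ge> 1"
  shows "dist_fun F t = 1"
proof -
  interpret prob_space F using outcome_distsD[OF assms(1)] by simp
  have "{a \<in> space F. a \<le> t} = space F" using outcome_distsD[OF assms(1)] assms(2) by auto
  then show ?thesis by (simp add: dist_fun_def prob_space)
qed

text \<open>Continuity from above of the measure, along decreasing events whose intersection is the
  event \<open>a \<le> t\<close>. It is what makes the infimum defining \<open>opt_action\<close>
  attained.\<close>

lemma dist_fun_right_continuous:
  assumes "F \<in> outcome_dists"
  shows "(\<lambda>k. dist_fun F (t + 1 / Suc k)) \<longlonglongrightarrow> dist_fun F t"
proof -
  interpret prob_space F using outcome_distsD[OF assms] by simp
  let ?A = "\<lambda>k::nat. {a \<in> space F. a \<le> t + 1 / Suc k}"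
  have "?A k \<in> sets F" for k :: nat
    using outcome_distsD[OF assms] by (intro measurable_real_pred_outcome) auto
  then have meas: "range ?A \<subseteq> sets F" by blast
  have "decseq ?A"
  proof (rule decseq_SucI)
    fix k :: nat
    have "1 / real (Suc (Suc k)) \<le> 1 / real (Suc k)" by (simp add: field_simps)
    then show "?A (Suc k) \<subseteq> ?A k" by auto
  qed
  moreover have "(\<Inter>k. ?A k) = {a \<in> space F. a \<le> t}"
  proof (rule set_eqI)
    fix a
    have "a \<le> t" if "\<And>k::nat. a \<le> t + 1 / Suc k"
    proof (rule field_le_epsilon)
      fix e :: real assume "e > 0"
      then obtain k :: nat where "1 / Suc k < e" by (metis nat_approx_posE)
      then show "a \<le> t + e" using that[of k] by linarith
    qed
    moreover have "a \<le> t + 1 / Suc k" if "a \<le> t" for k :: nat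
      using that by (simp add: add_increasing2)
    ultimately show "a \<in> (\<Inter>k. ?A k) \<longleftrightarrow> a \<in> {a \<in> space F. a \<le> t}" by auto
  qed
  ultimately show ?thesis
    unfolding dist_fun_def using finite_Lim_measure_decseq[OF meas] by simp
qed

section \<open>The newsvendor regret as an integral over levels\<close>

text \<open>A bounded measurable function is integrable on a product of two probability spaces. Used
  twice: with \<open>M\<close> the demand distribution and with \<open>M\<close> the law of the
  action.\<close>

lemma Fubini_unit_lebesgue:
  fixes f :: "'a \<Rightarrow> real \<Rightarrow> real"
  assumes "prob_space M"
    and meas: "case_prod f \<in> borel_measurable (M \<Otimes>\<^sub>M unit_lebesgue)"
    and bound: "\<And>y t. y \<in> space M \<Longrightarrow> t \<in> {0..<1} \<Longrightarrow> \<bar>f y t\<bar> \<le> B"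
  shows "(\<integral>y. (\<integral>t. f y t \<partial>unit_lebesgue) \<partial>M) = (\<integral>t. (\<integral>y. f y t \<partial>M) \<partial>unit_lebesgue)"
proof -
  interpret M: prob_space M by fact
  interpret U: prob_space unit_lebesgue by (rule prob_space_unit_lebesgue)
  interpret P: pair_prob_space M unit_lebesgue ..
  have "integrable (M \<Otimes>\<^sub>M unit_lebesgue) (case_prod f)"
    using bound meas
    by (intro P.integrable_const_bound[where B = B] AE_I2) (auto simp: space_pair_measure)
  from P.Fubini_integral[OF this] show ?thesis by simp
qed

text \<open>
  Because \<open>c\<^sub>o + c\<^sub>u = 1\<close>, the rate \<open>c\<^sub>o 1{y \<le> t < a} + c\<^sub>u 1{a \<le> t < y}\<close> at which the loss
  accumulates over levels \<open>t\<close> becomes affine in each of the indicators of \<open>y \<le> t\<close> and \<open>a \<le> t\<close>.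
\<close>

definition loss_rate :: "real \<Rightarrow> real \<Rightarrow> real \<Rightarrow> real \<Rightarrow> real" where
  "loss_rate c\<^sub>o c\<^sub>u v p = c\<^sub>o * v + (c\<^sub>u - v) * p"

lemma measurable_loss_rate[measurable]:
  assumes [measurable]: "f \<in> borel_measurable M" "g \<in> borel_measurable M"
  shows "(\<lambda>x. loss_rate c\<^sub>o c\<^sub>u (f x) (g x)) \<in> borel_measurable M"
  unfolding loss_rate_def by measurable

text \<open>Each of the two summands is at most 1 in absolute value. The crude constant only feeds
  integrability and boundedness arguments.\<close>

lemma loss_rate_bound:
  assumes "c\<^sub>o > 0" "c\<^sub>u > 0" "c\<^sub>o + c\<^sub>u = 1" "v \<in> {0..1}" "p \<in> {0..1}"
  shows "\<bar>loss_rate c\<^sub>o c\<^sub>u v p\<bar> \<le> 2"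
proof -
  have "\<bar>c\<^sub>o * v\<bar> \<le> 1 * 1" unfolding abs_mult using assms by (intro mult_mono) auto
  moreover have "\<bar>(c\<^sub>u - v) * p\<bar> \<le> 1 * 1" unfolding abs_mult using assms by (intro mult_mono) auto
  ultimately show ?thesis unfolding loss_rate_def by linarith
qed

lemma integrable_of_bool_le:
  "integrable unit_lebesgue (\<lambda>t. of_bool (y \<le> t) :: real)"
proof -
  interpret prob_space unit_lebesgue by (rule prob_space_unit_lebesgue)
  show ?thesis
    by (intro integrable_const_bound[where B = 1] measurable_restrict_space1) auto
qed

lemma integral_of_bool_le:
  assumes "y \<in> {0..1}"
  shows "(\<integral>t. of_bool (y \<le> t) \<partial>unit_lebesgue) = 1 - y"
proof -
  have "(\<integral>t. of_bool (y \<le> t) \<partial>unit_lebesgue) = (\<integral>t. indicator {y..<1} t \<partial>unit_lebesgue)"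
    by (intro Bochner_Integration.integral_cong) (auto simp: indicator_def)
  also have "\<dots> = measure lborel {y..<1}"
    using assms by (simp add: measure_restrict_space Int_absorb2 subset_eq)
  also have "\<dots> = 1 - y" using assms by simp
  finally show ?thesis .
qed

lemma newsvendor_loss_eq_integral:
  assumes "c\<^sub>o + c\<^sub>u = 1" "a \<in> {0..1}" "y \<in> {0..1}"
  shows "newsvendor_loss c\<^sub>o c\<^sub>u a y =
    (\<integral>t. loss_rate c\<^sub>o c\<^sub>u (of_bool (y \<le> t)) (of_bool (a \<le> t)) \<partial>unit_lebesgue)"
proof -
  have "(\<integral>t. loss_rate c\<^sub>o c\<^sub>u (of_bool (y \<le> t)) (of_bool (a \<le> t)) \<partial>unit_lebesgue) =
    (\<integral>t. c\<^sub>o * of_bool (y \<le> t) + c\<^sub>u * of_bool (a \<le> t) - of_bool (max a y \<le> t) \<partial>unit_lebesgue)"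
    by (intro Bochner_Integration.integral_cong) (auto simp: loss_rate_def)
  also have "\<dots> = c\<^sub>o * (1 - y) + c\<^sub>u * (1 - a) - (1 - max a y)"
    using assms integral_of_bool_le[of y] integral_of_bool_le[of a] integral_of_bool_le[of "max a y"]
    \<comment> \<open>Without \<open>max.bounded_iff\<close>, the condition on
      \<open>max a y\<close> stays whole and matches its integral.\<close>
    by (simp add: integrable_of_bool_le del: max.bounded_iff)
  also have "\<dots> = newsvendor_loss c\<^sub>o c\<^sub>u a y"
  proof -
    have cu: "c\<^sub>u = 1 - c\<^sub>o" using assms by simp
    show ?thesis unfolding newsvendor_loss_def cu by (auto simp: max_def algebra_simps)
  qed
  finally show ?thesis by simp
qed

text \<open>Joint measurability in outcome and level, as Fubini requires: both coordinates embed
  measurably in the real line.\<close>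

lemma measurable_le_pair_unit_lebesgue:
  assumes "sets M = sets outcome_space"
  shows "(\<lambda>p. of_bool (fst p \<le> snd p) :: real) \<in> borel_measurable (M \<Otimes>\<^sub>M unit_lebesgue)"
proof -
  have [measurable]: "(\<lambda>a. a) \<in> M \<rightarrow>\<^sub>M borel" "(\<lambda>a. a) \<in> unit_lebesgue \<rightarrow>\<^sub>M borel"
    using assms by (auto intro: measurable_outcome_real measurable_restrict_space1)
  have [measurable]: "fst \<in> (M \<Otimes>\<^sub>M unit_lebesgue) \<rightarrow>\<^sub>M borel" "snd \<in> (M \<Otimes>\<^sub>M unit_lebesgue) \<rightarrow>\<^sub>M borel"
    using measurable_compose[OF measurable_fst, of "\<lambda>a. a" M borel unit_lebesgue]
      measurable_compose[OF measurable_snd, of "\<lambda>a. a" unit_lebesgue borel M] by auto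
  show ?thesis by measurable
qed

lemma integrable_of_bool_outcome:
  assumes "F \<in> outcome_dists"
  shows "integrable F (\<lambda>y. of_bool (y \<le> t) :: real)"
proof -
  interpret prob_space F using outcome_distsD[OF assms] by simp
  have "(\<lambda>y. of_bool (y \<le> t) :: real) \<in> borel_measurable F"
    using outcome_distsD(2)[OF assms] by (rule measurable_outcome_real) measurable
  then show ?thesis by (intro integrable_const_bound[where B = 1]) auto
qed

text \<open>After Fubini, the rate is affine in the indicator of \<open>y \<le> t\<close>, so taking
  the expectation over \<open>y\<close> replaces that indicator by the cdf value.\<close>

lemma expected_loss_eq_integral:
  assumes c: "c\<^sub>o > 0" "c\<^sub>u > 0" "c\<^sub>o + c\<^sub>u = 1" and a: "a \<in> {0..1}" and F: "F \<in> outcome_dists"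
  shows "expected_loss c\<^sub>o c\<^sub>u a F =
    (\<integral>t. loss_rate c\<^sub>o c\<^sub>u (dist_fun F t) (of_bool (a \<le> t)) \<partial>unit_lebesgue)"
proof -
  note FD = outcome_distsD[OF F]
  note [measurable] = measurable_le_pair_unit_lebesgue[OF FD(2)]
  interpret prob_space F by (rule FD)
  have [measurable]: "(\<lambda>p. of_bool (a \<le> snd p) :: real) \<in> borel_measurable (F \<Otimes>\<^sub>M unit_lebesgue)"
    by (rule measurable_compose[OF measurable_snd]) (auto intro!: measurable_restrict_space1)
  have "expected_loss c\<^sub>o c\<^sub>u a F = (\<integral>y. (\<integral>t. loss_rate c\<^sub>o c\<^sub>u (of_bool (y \<le> t)) (of_bool (a \<le> t)) \<partial>unit_lebesgue) \<partial>F)"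
    unfolding expected_loss_def using c a FD
    by (intro Bochner_Integration.integral_cong) (auto simp: newsvendor_loss_eq_integral)
  also have "\<dots> = (\<integral>t. (\<integral>y. loss_rate c\<^sub>o c\<^sub>u (of_bool (y \<le> t)) (of_bool (a \<le> t)) \<partial>F) \<partial>unit_lebesgue)"
    using loss_rate_bound[OF c] FD
    by (intro Fubini_unit_lebesgue[where B = 2]) (auto simp: split_beta)
  also have "\<dots> = (\<integral>t. loss_rate c\<^sub>o c\<^sub>u (dist_fun F t) (of_bool (a \<le> t)) \<partial>unit_lebesgue)"
    using integrable_of_bool_outcome[OF F]
    by (intro Bochner_Integration.integral_cong)
      (auto simp: loss_rate_def dist_fun_eq_integral[OF F] prob_space algebra_simps simp del: of_bool_eq_0_iff)
  finally show ?thesis .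
qed

text \<open>The same argument in the other variable: the rate is also affine in the indicator of
  \<open>a \<le> t\<close>.\<close>

lemma randomized_loss_eq_integral:
  assumes c: "c\<^sub>o > 0" "c\<^sub>u > 0" "c\<^sub>o + c\<^sub>u = 1" and N: "\<nu> \<in> outcome_dists" and F: "F \<in> outcome_dists"
  shows "randomized_loss c\<^sub>o c\<^sub>u \<nu> F =
    (\<integral>t. loss_rate c\<^sub>o c\<^sub>u (dist_fun F t) (dist_fun \<nu> t) \<partial>unit_lebesgue)"
proof -
  note ND = outcome_distsD[OF N]
  note [measurable] = measurable_le_pair_unit_lebesgue[OF ND(2)]
  interpret prob_space \<nu> by (rule ND)
  have [measurable]: "(\<lambda>p. dist_fun F (snd p)) \<in> borel_measurable (\<nu> \<Otimes>\<^sub>M unit_lebesgue)"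
    using borel_measurable_dist_fun[OF F]
    by (intro measurable_compose[OF measurable_snd]) (auto intro!: measurable_restrict_space1)
  have "randomized_loss c\<^sub>o c\<^sub>u \<nu> F =
    (\<integral>a. (\<integral>t. loss_rate c\<^sub>o c\<^sub>u (dist_fun F t) (of_bool (a \<le> t)) \<partial>unit_lebesgue) \<partial>\<nu>)"
    unfolding randomized_loss_def using c ND F
    by (intro Bochner_Integration.integral_cong) (auto simp: expected_loss_eq_integral)
  also have "\<dots> = (\<integral>t. (\<integral>a. loss_rate c\<^sub>o c\<^sub>u (dist_fun F t) (of_bool (a \<le> t)) \<partial>\<nu>) \<partial>unit_lebesgue)"
    using loss_rate_bound[OF c dist_fun_bounds[OF F]] ND
    by (intro Fubini_unit_lebesgue[where B = 2]) (auto simp: split_beta)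
  also have "\<dots> = (\<integral>t. loss_rate c\<^sub>o c\<^sub>u (dist_fun F t) (dist_fun \<nu> t) \<partial>unit_lebesgue)"
    using integrable_of_bool_outcome[OF N]
    by (intro Bochner_Integration.integral_cong)
      (auto simp: loss_rate_def dist_fun_eq_integral[OF N] prob_space)
  finally show ?thesis .
qed

section \<open>Optimal action and regret per level\<close>

lemma integrable_loss_rate:
  assumes "c\<^sub>o > 0" "c\<^sub>u > 0" "c\<^sub>o + c\<^sub>u = 1"
    and "f \<in> borel_measurable borel" "g \<in> borel_measurable borel"
    and "\<And>t. f t \<in> {0..1}" "\<And>t. g t \<in> {0..1}"
  shows "integrable unit_lebesgue (\<lambda>t. loss_rate c\<^sub>o c\<^sub>u (f t) (g t))"
proof -
  interpret prob_space unit_lebesgue by (rule prob_space_unit_lebesgue)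
  have "(\<lambda>t. loss_rate c\<^sub>o c\<^sub>u (f t) (g t)) \<in> borel_measurable unit_lebesgue"
    using assms(4,5) by (intro measurable_loss_rate measurable_restrict_space1) auto
  then show ?thesis
    using loss_rate_bound[OF assms(1-3) assms(6,7)] by (intro integrable_const_bound[where B = 2]) auto
qed

text \<open>The critical ratio is \<open>c\<^sub>u\<close> since the costs sum to 1, and right
  continuity makes the infimum a minimum. Thus the point mass at the optimal action has a cdf
  determined at each level by the value of \<open>F\<close> at that level alone.\<close>

lemma opt_action_le_iff:
  assumes "c\<^sub>o > 0" "c\<^sub>u > 0" "c\<^sub>o + c\<^sub>u = 1" "F \<in> outcome_dists"
  shows "opt_action c\<^sub>o c\<^sub>u F \<in> {0..1}"
    and "t \<in> {0..1} \<Longrightarrow> opt_action c\<^sub>o c\<^sub>u F \<le> t \<longleftrightarrow> c\<^sub>u \<le> dist_fun F t"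
proof -
  define S where "S = {a \<in> {0..1}. c\<^sub>u \<le> dist_fun F a}"
  have opt: "opt_action c\<^sub>o c\<^sub>u F = Inf S"
    using assms by (simp add: opt_action_def critical_ratio_def S_def add.commute)
  have one: "1 \<in> S" using assms dist_fun_ge_1[of F 1] by (simp add: S_def)
  have bdd: "bdd_below S" by (auto simp: S_def intro: bdd_belowI[of _ 0])
  have "0 \<le> Inf S" using one by (intro cInf_greatest) (auto simp: S_def)
  moreover have "Inf S \<le> 1" by (rule cInf_lower[OF one bdd])
  ultimately show "opt_action c\<^sub>o c\<^sub>u F \<in> {0..1}" by (simp add: opt)
  assume t: "t \<in> {0..1}"
  show "opt_action c\<^sub>o c\<^sub>u F \<le> t \<longleftrightarrow> c\<^sub>u \<le> dist_fun F t"
  proof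
    assume le: "opt_action c\<^sub>o c\<^sub>u F \<le> t"
    \<comment> \<open>Strictly above the infimum there is a member of \<open>S\<close> to the left,
      and monotonicity passes its bound on. Letting \<open>k\<close> grow then reaches
      \<open>t\<close> itself.\<close>
    have "c\<^sub>u \<le> dist_fun F (t + 1 / Suc k)" for k :: nat
    proof -
      have "Inf S < t + 1 / Suc k" using le opt by (simp add: add_strict_increasing2 le_less_trans)
      then obtain s where "s \<in> S" "s < t + 1 / Suc k"
        using cInf_lessD[of S] one by blast
      then show ?thesis
        using monoD[OF dist_fun_mono[OF assms(4)], of s "t + 1 / Suc k"] by (simp add: S_def)
    qed
    then show "c\<^sub>u \<le> dist_fun F t"
      by (intro LIMSEQ_le_const[OF dist_fun_right_continuous[OF assms(4)]]) auto
  next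
    assume "c\<^sub>u \<le> dist_fun F t"
    then have "t \<in> S" using t by (simp add: S_def)
    then show "opt_action c\<^sub>o c\<^sub>u F \<le> t" unfolding opt by (rule cInf_lower[OF _ bdd])
  qed
qed

text \<open>Difference of two values of \<open>loss_rate\<close>, at \<open>p\<close> and at the cdf
  value of the optimal action; the term \<open>c\<^sub>o * v\<close> cancels. It is non-negative for
  \<open>p\<close> in \<open>[0,1]\<close>.\<close>

definition regret_rate :: "real \<Rightarrow> real \<Rightarrow> real \<Rightarrow> real" where
  "regret_rate c\<^sub>u v p = (c\<^sub>u - v) * (p - of_bool (c\<^sub>u \<le> v))"

lemma regret_eq_integral:
  assumes c: "c\<^sub>o > 0" "c\<^sub>u > 0" "c\<^sub>o + c\<^sub>u = 1" and N: "\<nu> \<in> outcome_dists" and F: "F \<in> outcome_dists"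
  shows "integrable unit_lebesgue (\<lambda>t. regret_rate c\<^sub>u (dist_fun F t) (dist_fun \<nu> t))" (is ?int)
    and "regret c\<^sub>o c\<^sub>u \<nu> F =
      (\<integral>t. regret_rate c\<^sub>u (dist_fun F t) (dist_fun \<nu> t) \<partial>unit_lebesgue)" (is ?eq)
proof -
  let ?f = "\<lambda>t. loss_rate c\<^sub>o c\<^sub>u (dist_fun F t) (dist_fun \<nu> t)"
  let ?g = "\<lambda>t. loss_rate c\<^sub>o c\<^sub>u (dist_fun F t) (of_bool (opt_action c\<^sub>o c\<^sub>u F \<le> t))"
  have int: "integrable unit_lebesgue ?f" "integrable unit_lebesgue ?g"
    using dist_fun_bounds[OF F] dist_fun_bounds[OF N]
    by (auto intro!: integrable_loss_rate c borel_measurable_dist_fun F N)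
  have rate: "?f t - ?g t = regret_rate c\<^sub>u (dist_fun F t) (dist_fun \<nu> t)"
    if "t \<in> space unit_lebesgue" for t
    using opt_action_le_iff(2)[OF c F, of t] that
    by (simp add: loss_rate_def regret_rate_def algebra_simps)
  have "integrable unit_lebesgue (\<lambda>t. ?f t - ?g t)" using int by simp
  then show ?int by (subst Bochner_Integration.integrable_cong[OF refl rate[symmetric]]) auto
  have "regret c\<^sub>o c\<^sub>u \<nu> F = (\<integral>t. ?f t - ?g t \<partial>unit_lebesgue)"
    unfolding regret_def
    using int by (simp add: randomized_loss_eq_integral[OF c N F]
      expected_loss_eq_integral[OF c opt_action_le_iff(1)[OF c F] F])
  also have "\<dots> = (\<integral>t. regret_rate c\<^sub>u (dist_fun F t) (dist_fun \<nu> t) \<partial>unit_lebesgue)"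
    by (intro Bochner_Integration.integral_cong rate) auto
  finally show ?eq .
qed

section \<open>Averaging over the samples\<close>

lemma PiM_outcome_dists:
  assumes "F \<in> I \<rightarrow>\<^sub>E outcome_dists"
  shows "(\<Pi>\<^sub>M i\<in>I. F i) \<in> space (prob_algebra (\<Pi>\<^sub>M i\<in>I. outcome_space))"
proof -
  have "prob_space (F i)" "sets (F i) = sets outcome_space" if "i \<in> I" for i
    using outcome_distsD[of "F i"] assms that by auto
  then show ?thesis by (auto simp: space_prob_algebra intro!: prob_space_PiM sets_PiM_cong)
qed

text \<open>The level formula is a parameter integral of a jointly measurable function, and it is
  valid on all of \<open>outcome_space\<close>.\<close>

lemma borel_measurable_expected_loss:
  assumes c: "c\<^sub>o > 0" "c\<^sub>u > 0" "c\<^sub>o + c\<^sub>u = 1" and F: "F \<in> outcome_dists"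
  shows "(\<lambda>a. expected_loss c\<^sub>o c\<^sub>u a F) \<in> borel_measurable outcome_space"
proof -
  interpret U: prob_space unit_lebesgue by (rule prob_space_unit_lebesgue)
  note [measurable] = measurable_le_pair_unit_lebesgue[of outcome_space, OF refl]
  have [measurable]: "(\<lambda>p. dist_fun F (snd p)) \<in> borel_measurable (outcome_space \<Otimes>\<^sub>M unit_lebesgue)"
    using borel_measurable_dist_fun[OF F]
    by (intro measurable_compose[OF measurable_snd]) (auto intro!: measurable_restrict_space1)
  have "(\<lambda>a. \<integral>t. loss_rate c\<^sub>o c\<^sub>u (dist_fun F t) (of_bool (a \<le> t)) \<partial>unit_lebesgue)
      \<in> borel_measurable outcome_space"
    by (rule U.borel_measurable_lebesgue_integral) (simp add: split_beta)
  then show ?thesis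
    by (subst measurable_cong[OF expected_loss_eq_integral[OF c _ F]]) (auto simp: space_outcome_space)
qed

lemma abs_expected_loss_le:
  assumes c: "c\<^sub>o > 0" "c\<^sub>u > 0" "c\<^sub>o + c\<^sub>u = 1" and F: "F \<in> outcome_dists" and a: "a \<in> {0..1}"
  shows "\<bar>expected_loss c\<^sub>o c\<^sub>u a F\<bar> \<le> 2"
proof -
  interpret U: prob_space unit_lebesgue by (rule prob_space_unit_lebesgue)
  have int: "integrable unit_lebesgue (\<lambda>t. loss_rate c\<^sub>o c\<^sub>u (dist_fun F t) (of_bool (a \<le> t)))"
    using dist_fun_bounds[OF F] by (auto intro!: integrable_loss_rate c borel_measurable_dist_fun F)
  have b: "-2 \<le> loss_rate c\<^sub>o c\<^sub>u (dist_fun F t) (of_bool (a \<le> t))"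
     "loss_rate c\<^sub>o c\<^sub>u (dist_fun F t) (of_bool (a \<le> t)) \<le> 2" for t
    using loss_rate_bound[OF c dist_fun_bounds[OF F], of "of_bool (a \<le> t)" t] by (auto split: if_splits)
  show ?thesis
    unfolding expected_loss_eq_integral[OF c a F]
    using U.integral_ge_const[OF int, of "-2"] U.integral_le_const[OF int, of 2] b by auto
qed

lemma bind_outcome_dists:
  assumes "F \<in> I \<rightarrow>\<^sub>E outcome_dists"
    and "K \<in> (\<Pi>\<^sub>M i\<in>I. outcome_space) \<rightarrow>\<^sub>M prob_algebra outcome_space"
  shows "(\<Pi>\<^sub>M i\<in>I. F i) \<bind> K \<in> outcome_dists"
  using prob_space_bind'[OF PiM_outcome_dists[OF assms(1)] assms(2)]
    sets_bind'[OF PiM_outcome_dists[OF assms(1)] assms(2)]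
  by (simp add: outcome_dists_def space_prob_algebra)

text \<open>The loss is linear in the law of the action and the optimal loss does not depend on the
  samples, so averaging over samples can be moved into that law. Separability describes exactly the
  cdf of this averaged law.\<close>

lemma expected_regret_eq_regret_bind:
  assumes c: "c\<^sub>o > 0" "c\<^sub>u > 0" "c\<^sub>o + c\<^sub>u = 1" and F0: "F\<^sub>0 \<in> outcome_dists"
    and F: "F \<in> {1..n} \<rightarrow>\<^sub>E outcome_dists"
    and K: "\<pi> x \<in> (\<Pi>\<^sub>M i\<in>{1..n}. outcome_space) \<rightarrow>\<^sub>M prob_algebra outcome_space"
  shows "expected_regret c\<^sub>o c\<^sub>u n \<pi> x F\<^sub>0 F = regret c\<^sub>o c\<^sub>u ((\<Pi>\<^sub>M i\<in>{1..n}. F i) \<bind> \<pi> x) F\<^sub>0"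
proof -
  let ?M = "\<Pi>\<^sub>M i\<in>{1..n}. F i"
  have M: "prob_space ?M" "sets ?M = sets (\<Pi>\<^sub>M i\<in>{1..n}. outcome_space)"
    using PiM_outcome_dists[OF F] by (auto simp: space_prob_algebra)
  interpret prob_space ?M by (rule M)
  have K': "\<pi> x \<in> ?M \<rightarrow>\<^sub>M prob_algebra outcome_space"
    using K M(2) by (simp cong: measurable_cong_sets)
  note K'' = measurable_prob_algebraD[OF K']
  have sub: "\<pi> x y \<in> outcome_dists" if "y \<in> space ?M" for y
    using measurable_space[OF K' that] by (simp add: outcome_dists_def)
  have bd: "\<bar>expected_loss c\<^sub>o c\<^sub>u a F\<^sub>0\<bar> \<le> 2" if "a \<in> space outcome_space" for a
    using abs_expected_loss_le[OF c F0] that by (simp add: space_outcome_space)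
  note meas = borel_measurable_expected_loss[OF c F0]
  have bind: "(\<integral>a. expected_loss c\<^sub>o c\<^sub>u a F\<^sub>0 \<partial>(?M \<bind> \<pi> x)) =
      (\<integral>y. (\<integral>a. expected_loss c\<^sub>o c\<^sub>u a F\<^sub>0 \<partial>\<pi> x y) \<partial>?M)"
    using outcome_distsD(1)[OF sub]
    by (intro integral_bind[OF meas bd K'' finite_measure_axioms, where B' = 1] AE_I2)
      (auto simp: prob_space.emeasure_space_1)
  \<comment> \<open>Needed to split the integral of the regret into random loss minus constant.
    Measurability in \<open>y\<close> comes from the kernel, the bound from the bounded
    loss.\<close>
  have "integrable ?M (\<lambda>y. randomized_loss c\<^sub>o c\<^sub>u (\<pi> x y) F\<^sub>0)"
  proof (rule integrable_const_bound[where B = 2])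
    show "(\<lambda>y. randomized_loss c\<^sub>o c\<^sub>u (\<pi> x y) F\<^sub>0) \<in> borel_measurable ?M"
      unfolding randomized_loss_def
      by (rule measurable_compose[OF K'' integral_measurable_subprob_algebra[OF meas]])
    have "\<bar>\<integral>a. expected_loss c\<^sub>o c\<^sub>u a F\<^sub>0 \<partial>\<pi> x y\<bar> \<le> 2" if "y \<in> space ?M" for y
    proof -
      note D = outcome_distsD[OF sub[OF that]]
      interpret N: prob_space "\<pi> x y" by (rule D)
      have "(\<lambda>a. expected_loss c\<^sub>o c\<^sub>u a F\<^sub>0) \<in> borel_measurable (\<pi> x y)"
        using meas D(2) by (simp cong: measurable_cong_sets)
      then have int: "integrable (\<pi> x y) (\<lambda>a. expected_loss c\<^sub>o c\<^sub>u a F\<^sub>0)"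
        using bd D(3) by (intro N.integrable_const_bound[where B = 2] AE_I2) (auto simp: space_outcome_space)
      have "-2 \<le> expected_loss c\<^sub>o c\<^sub>u a F\<^sub>0" "expected_loss c\<^sub>o c\<^sub>u a F\<^sub>0 \<le> 2"
        if "a \<in> space (\<pi> x y)" for a
        using bd[of a] that D(3) by (auto simp: space_outcome_space)
      then show ?thesis
        using N.integral_ge_const[OF int AE_I2, of "-2"] N.integral_le_const[OF int AE_I2, of 2] by auto
    qed
    then show "AE y in ?M. norm (randomized_loss c\<^sub>o c\<^sub>u (\<pi> x y) F\<^sub>0) \<le> 2"
      unfolding randomized_loss_def by (intro AE_I2) (simp only: real_norm_def)
  qed
  then show ?thesis
    by (simp add: expected_regret_def regret_def prob_space randomized_loss_def bind
      del: One_nat_def)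
qed

text \<open>\<open>P\<close> is an arbitrary function here; integrability of the expression in
  \<open>P\<close> is inherited from the cdf of the averaged law, with which it coincides.\<close>

lemma expected_regret_eq_integral:
  assumes c: "c\<^sub>o > 0" "c\<^sub>u > 0" "c\<^sub>o + c\<^sub>u = 1" and F0: "F\<^sub>0 \<in> outcome_dists"
    and F: "F \<in> {1..n} \<rightarrow>\<^sub>E outcome_dists"
    and K: "\<pi> x \<in> (\<Pi>\<^sub>M i\<in>{1..n}. outcome_space) \<rightarrow>\<^sub>M prob_algebra outcome_space"
    and P: "\<And>F y. F \<in> {1..n} \<rightarrow>\<^sub>E outcome_dists \<Longrightarrow>
      dist_fun ((\<Pi>\<^sub>M i\<in>{1..n}. F i) \<bind> \<pi> x) y = P (\<lambda>i\<in>{1..n}. dist_fun (F i) y)"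
  shows "integrable unit_lebesgue (\<lambda>t. regret_rate c\<^sub>u (dist_fun F\<^sub>0 t) (P (\<lambda>i\<in>{1..n}. dist_fun (F i) t)))"
    and "expected_regret c\<^sub>o c\<^sub>u n \<pi> x F\<^sub>0 F =
      (\<integral>t. regret_rate c\<^sub>u (dist_fun F\<^sub>0 t) (P (\<lambda>i\<in>{1..n}. dist_fun (F i) t)) \<partial>unit_lebesgue)"
  using regret_eq_integral[OF c bind_outcome_dists[OF F K] F0]
    expected_regret_eq_regret_bind[where \<pi> = \<pi> and x = x, OF c F0 F K]
  by (simp_all only: P[OF F])

section \<open>Bernoulli distributions\<close>

text \<open>\<open>bernoulli_pmf\<close> yields a probability mass function for every real argument,
  and \<open>of_bool\<close> takes values in \<open>[0,1]\<close>.\<close>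

lemma bernoulli_dist_outcome_dists: "bernoulli_dist \<mu> \<in> outcome_dists"
proof -
  have "of_bool \<in> measure_pmf (bernoulli_pmf \<mu>) \<rightarrow>\<^sub>M outcome_space"
    by (auto simp: measurable_def space_outcome_space)
  then show ?thesis
    by (auto simp: bernoulli_dist_def outcome_dists_def space_prob_algebra
      intro!: prob_space.prob_space_distr measure_pmf.prob_space_axioms)
qed

text \<open>Below level 1 only the atom at 0 counts.\<close>

lemma dist_fun_bernoulli_dist:
  assumes "\<mu> \<in> {0..1}" "t \<in> {0..<1}"
  shows "dist_fun (bernoulli_dist \<mu>) t = 1 - \<mu>"
proof -
  have m: "of_bool \<in> measure_pmf (bernoulli_pmf \<mu>) \<rightarrow>\<^sub>M outcome_space"
    by (auto simp: measurable_def space_outcome_space)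
  have s: "{a \<in> space outcome_space. a \<le> t} \<in> sets outcome_space"
    by (intro measurable_real_pred_outcome) auto
  have "of_bool -` {a \<in> space outcome_space. a \<le> t} = {False}"
    using assms by (auto simp: space_outcome_space of_bool_def split: if_splits)
  then show ?thesis
    using assms m s by (simp add: dist_fun_def bernoulli_dist_def measure_distr measure_pmf_single)
qed

text \<open>The two cdfs agree outside \<open>[0,1)\<close> and differ by a constant inside. This
  makes the Bernoulli instances feasible for the general problem.\<close>

lemma kolmogorov_dist_bernoulli_dist_le:
  assumes "\<mu> \<in> {0..1}" "\<mu>' \<in> {0..1}"
  shows "kolmogorov_dist (bernoulli_dist \<mu>) (bernoulli_dist \<mu>') \<le> \<bar>\<mu>' - \<mu>\<bar>"
  unfolding kolmogorov_dist_def
proof (rule cSUP_least)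
  fix y :: real
  consider "y < 0" | "y \<in> {0..<1}" | "y \<ge> 1" by fastforce
  then show "\<bar>dist_fun (bernoulli_dist \<mu>) y - dist_fun (bernoulli_dist \<mu>') y\<bar> \<le> \<bar>\<mu>' - \<mu>\<bar>"
    using assms
    by cases (simp_all add: dist_fun_neg dist_fun_ge_1 dist_fun_bernoulli_dist bernoulli_dist_outcome_dists)
qed simp

text \<open>The supremum is taken in the reals, so it dominates its members only because cdf
  differences are bounded, here by 1.\<close>

lemma abs_dist_fun_diff_le_kolmogorov_dist:
  assumes "F \<in> outcome_dists" "G \<in> outcome_dists"
  shows "\<bar>dist_fun F y - dist_fun G y\<bar> \<le> kolmogorov_dist F G"
  unfolding kolmogorov_dist_def
proof (rule cSUP_upper)
  have "\<bar>dist_fun F t - dist_fun G t\<bar> \<le> 1" for t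
    using dist_fun_bounds[OF assms(1), of t] dist_fun_bounds[OF assms(2), of t] by auto
  then show "bdd_above (range (\<lambda>y. \<bar>dist_fun F y - dist_fun G y\<bar>))" by (auto intro: bdd_aboveI[of _ 1])
qed simp

section \<open>Reduction of the worst case to Bernoulli instances\<close>

theorem proposition1:
  fixes c\<^sub>o c\<^sub>u :: real and d :: "'x \<Rightarrow> 'x \<Rightarrow> real"
    and n :: nat and x :: "nat \<Rightarrow> 'x" and \<pi> :: "'x policy"
  assumes "c\<^sub>o > 0" and "c\<^sub>u > 0" and "c\<^sub>o + c\<^sub>u = 1"
    and "\<And>u v. d u v \<ge> 0"
    and "n \<ge> 1"
    and "x \<in> context_seqs n"
    and "data_driven_policy n \<pi>"
    and "separable n x \<pi>"
  shows "worst_case_regret c\<^sub>o c\<^sub>u d n \<pi> x =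
    (SUP \<mu>\<^sub>0 \<in> {0..1::real}.
     SUP \<mu> \<in> {\<mu> \<in> {1..n} \<rightarrow>\<^sub>E {0..1::real}. \<forall>i\<in>{1..n}. \<bar>\<mu> i - \<mu>\<^sub>0\<bar> \<le> d (x 0) (x i)}.
       ereal (expected_regret c\<^sub>o c\<^sub>u n \<pi> x (bernoulli_dist \<mu>\<^sub>0) (\<lambda>i\<in>{1..n}. bernoulli_dist (\<mu> i))))"
proof -
  note c = assms(1-3)
  let ?U = "\<lambda>\<mu>\<^sub>0. {\<mu> \<in> {1..n} \<rightarrow>\<^sub>E {0..1::real}. \<forall>i\<in>{1..n}. \<bar>\<mu> i - \<mu>\<^sub>0\<bar> \<le> d (x 0) (x i)}"
  let ?A = "\<lambda>F\<^sub>0. {F \<in> {1..n} \<rightarrow>\<^sub>E outcome_dists. \<forall>i\<in>{1..n}. kolmogorov_dist F\<^sub>0 (F i) \<le> d (x 0) (x i)}"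
  let ?B = "\<lambda>\<mu>. \<lambda>i\<in>{1..n}. bernoulli_dist (\<mu> i)"
  let ?R = "\<lambda>\<mu>\<^sub>0 \<mu>. expected_regret c\<^sub>o c\<^sub>u n \<pi> x (bernoulli_dist \<mu>\<^sub>0) (?B \<mu>)"
  let ?S = "SUP \<mu>\<^sub>0 \<in> {0..1::real}. SUP \<mu> \<in> ?U \<mu>\<^sub>0. ereal (?R \<mu>\<^sub>0 \<mu>)"
  interpret U: prob_space unit_lebesgue by (rule prob_space_unit_lebesgue)
  have K: "\<pi> x \<in> (\<Pi>\<^sub>M i\<in>{1..n}. outcome_space) \<rightarrow>\<^sub>M prob_algebra outcome_space"
    using assms(6,7) by (simp add: data_driven_policy_def)
  obtain P where P: "\<And>F y. F \<in> {1..n} \<rightarrow>\<^sub>E outcome_dists \<Longrightarrow>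
      dist_fun ((\<Pi>\<^sub>M i\<in>{1..n}. F i) \<bind> \<pi> x) y = P (\<lambda>i\<in>{1..n}. dist_fun (F i) y)"
    using assms(8) unfolding separable_def by blast
  note er = expected_regret_eq_integral[where \<pi> = \<pi> and x = x, OF c _ _ K P]
  have B: "?B \<mu> \<in> {1..n} \<rightarrow>\<^sub>E outcome_dists" for \<mu>
    by (auto simp: bernoulli_dist_outcome_dists)
  \<comment> \<open>All cdfs involved are constant on \<open>[0,1)\<close>, so the integrand is
    constant and the total mass 1 returns its value.\<close>
  have bern: "?R \<mu>\<^sub>0 \<mu> = regret_rate c\<^sub>u (1 - \<mu>\<^sub>0) (P (\<lambda>i\<in>{1..n}. 1 - \<mu> i))"
    if "\<mu>\<^sub>0 \<in> {0..1}" "\<mu> \<in> {1..n} \<rightarrow>\<^sub>E {0..1}" for \<mu>\<^sub>0 \<mu>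
  proof -
    have "?R \<mu>\<^sub>0 \<mu> = (\<integral>t. regret_rate c\<^sub>u (dist_fun (bernoulli_dist \<mu>\<^sub>0) t)
        (P (\<lambda>i\<in>{1..n}. dist_fun (?B \<mu> i) t)) \<partial>unit_lebesgue)"
      by (intro er(2) B bernoulli_dist_outcome_dists)
    also have "\<dots> = (\<integral>t. regret_rate c\<^sub>u (1 - \<mu>\<^sub>0) (P (\<lambda>i\<in>{1..n}. 1 - \<mu> i)) \<partial>unit_lebesgue)"
    proof (intro Bochner_Integration.integral_cong refl)
      fix t assume "t \<in> space unit_lebesgue"
      then have t: "t \<in> {0..<1}" by simp
      have "(\<lambda>i\<in>{1..n}. dist_fun (?B \<mu> i) t) = (\<lambda>i\<in>{1..n}. 1 - \<mu> i)"
      proof (rule restrict_ext)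
        fix i assume i: "i \<in> {1..n}"
        with that(2) have "\<mu> i \<in> {0..1}" by blast
        from dist_fun_bernoulli_dist[OF this t] i show "dist_fun (?B \<mu> i) t = 1 - \<mu> i" by simp
      qed
      then show "regret_rate c\<^sub>u (dist_fun (bernoulli_dist \<mu>\<^sub>0) t) (P (\<lambda>i\<in>{1..n}. dist_fun (?B \<mu> i) t)) =
          regret_rate c\<^sub>u (1 - \<mu>\<^sub>0) (P (\<lambda>i\<in>{1..n}. 1 - \<mu> i))"
        using dist_fun_bernoulli_dist[OF that(1) t] by simp
    qed
    finally show ?thesis by (simp only: U.prob_space lebesgue_integral_const) simp
  qed
  \<comment> \<open>Upper bound: the regret of a general feasible instance is the average of
    \<open>g\<close>, each of whose values is a Bernoulli regret.\<close>
  have "ereal (expected_regret c\<^sub>o c\<^sub>u n \<pi> x F\<^sub>0 F) \<le> ?S"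
    if F0: "F\<^sub>0 \<in> outcome_dists" and F: "F \<in> ?A F\<^sub>0" for F\<^sub>0 F
  proof -
    have FP: "F \<in> {1..n} \<rightarrow>\<^sub>E outcome_dists" using F by simp
    define g where "g = (\<lambda>t. regret_rate c\<^sub>u (dist_fun F\<^sub>0 t) (P (\<lambda>i\<in>{1..n}. dist_fun (F i) t)))"
    have int: "integrable unit_lebesgue g" using er(1)[OF F0 FP] by (simp only: g_def)
    have eq: "expected_regret c\<^sub>o c\<^sub>u n \<pi> x F\<^sub>0 F = integral\<^sup>L unit_lebesgue g"
      using er(2)[OF F0 FP] by (simp only: g_def)
    have gS: "ereal (g t) \<le> ?S" for t
    proof -
      \<comment> \<open>A Bernoulli cdf on \<open>[0,1)\<close> is one minus the mean, so these
        means reproduce the cdf values of the given instance at level \<open>t\<close>.\<close>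
      define \<mu>\<^sub>0 where "\<mu>\<^sub>0 = 1 - dist_fun F\<^sub>0 t"
      define \<mu> where "\<mu> = (\<lambda>i\<in>{1..n}. 1 - dist_fun (F i) t)"
      have m0: "\<mu>\<^sub>0 \<in> {0..1}" using dist_fun_bounds[OF F0, of t] by (simp add: \<mu>\<^sub>0_def)
      have Fi: "F i \<in> outcome_dists" if "i \<in> {1..n}" for i using FP that by blast
      have m: "\<mu> \<in> {1..n} \<rightarrow>\<^sub>E {0..1}" using dist_fun_bounds[OF Fi, of _ t] by (auto simp: \<mu>_def)
      have "\<bar>\<mu> i - \<mu>\<^sub>0\<bar> \<le> d (x 0) (x i)" if i: "i \<in> {1..n}" for i
      proof -
        have "\<bar>\<mu> i - \<mu>\<^sub>0\<bar> = \<bar>dist_fun F\<^sub>0 t - dist_fun (F i) t\<bar>" using i by (simp add: \<mu>_def \<mu>\<^sub>0_def)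
        also have "\<dots> \<le> kolmogorov_dist F\<^sub>0 (F i)"
          by (rule abs_dist_fun_diff_le_kolmogorov_dist[OF F0 Fi[OF i]])
        also have "\<dots> \<le> d (x 0) (x i)" using F i by simp
        finally show ?thesis .
      qed
      then have mU: "\<mu> \<in> ?U \<mu>\<^sub>0" using m by simp
      have "(\<lambda>i\<in>{1..n}. 1 - \<mu> i) = (\<lambda>i\<in>{1..n}. dist_fun (F i) t)"
        by (intro restrict_ext) (simp add: \<mu>_def)
      then have "g t = ?R \<mu>\<^sub>0 \<mu>" unfolding bern[OF m0 m] g_def by (simp add: \<mu>\<^sub>0_def)
      then show ?thesis using m0 mU by (auto intro!: SUP_upper2)
    qed
    show ?thesis
    \<comment> \<open>The bound on the average is a statement about reals, so \<open>?S\<close> has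
      to be finite. The value at plus infinity is trivial, and minus infinity is impossible because
      \<open>?S\<close> dominates the real number \<open>g 0\<close>.\<close>
    proof (cases ?S)
      case (real r)
      then have "integral\<^sup>L unit_lebesgue g \<le> r"
        using gS by (intro U.integral_le_const[OF int]) simp
      then show ?thesis using real eq by simp
    next
      case PInf
      then show ?thesis by simp
    next
      case MInf
      then show ?thesis using gS[of 0] by simp
    qed
  qed
  then have "worst_case_regret c\<^sub>o c\<^sub>u d n \<pi> x \<le> ?S"
    unfolding worst_case_regret_def by (intro SUP_least)
  \<comment> \<open>Converse: every Bernoulli instance satisfying the mean constraints also
    satisfies the Kolmogorov constraints.\<close>
  moreover have "?S \<le> worst_case_regret c\<^sub>o c\<^sub>u d n \<pi> x"
    unfolding worst_case_regret_def
  proof (intro SUP_least)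
    fix \<mu>\<^sub>0 \<mu> assume m: "\<mu>\<^sub>0 \<in> {0..1::real}" "\<mu> \<in> ?U \<mu>\<^sub>0"
    have "kolmogorov_dist (bernoulli_dist \<mu>\<^sub>0) (?B \<mu> i) \<le> d (x 0) (x i)" if i: "i \<in> {1..n}" for i
      using kolmogorov_dist_bernoulli_dist_le[OF m(1), of "\<mu> i"] m(2) i by fastforce
    then have "?B \<mu> \<in> ?A (bernoulli_dist \<mu>\<^sub>0)" using B by simp
    then have "ereal (?R \<mu>\<^sub>0 \<mu>) \<le> (SUP F \<in> ?A (bernoulli_dist \<mu>\<^sub>0).
        ereal (expected_regret c\<^sub>o c\<^sub>u n \<pi> x (bernoulli_dist \<mu>\<^sub>0) F))"
      by (rule SUP_upper)
    then show "ereal (?R \<mu>\<^sub>0 \<mu>) \<le> (SUP F\<^sub>0 \<in> outcome_dists. SUP F \<in> ?A F\<^sub>0.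
        ereal (expected_regret c\<^sub>o c\<^sub>u n \<pi> x F\<^sub>0 F))"
      by (rule SUP_upper2[OF bernoulli_dist_outcome_dists])
  qed
  ultimately show ?thesis by (rule antisym)
qed

end
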